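(* Let $k\ge 1$ and let $\widehat{\mathcal{A}}=(\mathcal{A}_0,\mathcal{A}_1,\dots,\mathcal{A}_k)$ be a tuple of tensors in $\mathbb{T}(m,n)$, where $m$ is even. If $\widehat{\mathcal{A}}$ is an $\mathbb{EHE}$ tensor, then the solution set $\mathrm{SOL}(\widehat{\mathcal{A}},\widehat{\mathbf d},q)$ is nonempty and compact for every tuple $\widehat{\mathbf d}=(d_1,\dots,d_{k-1})$ of vectors in $\mathbb{R}^n_{++}$ and every $q\in\mathbb{R}^n$.
   Context: Let $m,n$ be positive integers. $\mathbb{T}(m,n)$ is the set of real tensors $\mathcal{A}=(a_{i_1\dots i_m})$ of order $m$ and dimension $n$ ($i_1,\dots,i_m\in\{1,\dots,n\}$; no symmetry assumed). For $x\in\mathbb{R}^n$, $\mathcal{A}x^{m-1}\in\mathbb{R}^n$ is defined by $(\mathcal{A}x^{m-1})_i=\sum_{i_2,\dots,i_m=1}^n a_{ii_2\dots i_m}x_{i_2}\cdots x_{i_m}$. $x\wedge y$ is the componentwise minimum, $x\ast y$ the componentwise product, and vector inequalities are componentwise. $\mathbb{R}^n_{++}$ is the set of vectors with all components $>0$. Write $[k]=\{1,\dots,k\}$. $\mathrm{SOL}(\widehat{\mathcal{A}},\widehat{\mathbf d},q)$ is the set of $(x_0,x_1,\dots,x_k)\in(\mathbb{R}^n)^{k+1}$ such that $\mathcal{A}_0x_0^{m-1}=q+\sum_{j=1}^k\mathcal{A}_jx_j^{m-1}$, $x_0\wedge x_1=0$, and $(d_j-x_j)\wedge x_{j+1}=0$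 for $j\in[k-1]$ (if $k=1$, $\widehat{\mathbf d}$ is the empty tuple and the last conditions are void). $\widehat{\mathcal{A}}$ is an $\mathbb{EHE}$ tensor if the only $(x_0,\dots,x_k)\in(\mathbb{R}^n)^{k+1}$ with $\mathcal{A}_0x_0^{m-1}=\sum_{j=1}^k\mathcal{A}_jx_j^{m-1}$, $x_i\ge 0$ for all $i\in[k]$, and $x_0\ast x_i\le 0$ for all $i\in[k]$ is $x_0=x_1=\dots=x_k=0$. *)

theory Defs
  imports "HOL-Analysis.Analysis"
begin

text \<open>
  A tensor of order \<open>m\<close> whose dimension is the cardinality of the finite type \<open>'n\<close> is given by its
  entries at the multi-indices \<open>[i\<^sub>1, \<dots>, i\<^sub>m]\<close>, i.e. at the lists of length \<open>m\<close>. The order is not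
  recorded in the type: it is an explicit parameter of the operations below, which read the
  entries at lists of length \<open>m\<close> only.
\<close>

type_synonym 'n tensor = "'n list \<Rightarrow> real"

definition tensor_apply :: "nat \<Rightarrow> 'n::finite tensor \<Rightarrow> real^'n \<Rightarrow> real^'n" where
  "tensor_apply m A x =
     (\<chi> i. \<Sum>js | length js = m - 1. A (i # js) * prod_list (map (\<lambda>j. x $ j) js))"

text \<open>
  The space \<open>(\<real>\<^sup>n)\<^sup>k\<^sup>+\<^sup>1\<close>: tuples \<open>(x\<^sub>0, \<dots>, x\<^sub>k)\<close> are the extensional functions on \<open>{0..k}\<close>
  (so they carry no information outside this index set), with the product topology.
\<close>

definition tuple_topology :: "nat \<Rightarrow> (nat \<Rightarrow> real^'n::finite) topology" where
  "tuple_topology k = product_topology (\<lambda>_. euclidean) {0..k}"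

text \<open>
  On \<open>real^'n\<close>, the operations \<open>inf\<close>, \<open>*\<close> and \<open>\<le>\<close> of the library are componentwise.
\<close>

definition SOL :: "nat \<Rightarrow> nat \<Rightarrow> (nat \<Rightarrow> 'n::finite tensor) \<Rightarrow> (nat \<Rightarrow> real^'n) \<Rightarrow> real^'n
    \<Rightarrow> (nat \<Rightarrow> real^'n) set" where
  "SOL m k A d q =
     {x \<in> {0..k} \<rightarrow>\<^sub>E UNIV.
        tensor_apply m (A 0) (x 0) = q + (\<Sum>j = 1..k. tensor_apply m (A j) (x j)) \<and>
        inf (x 0) (x 1) = 0 \<and>
        (\<forall>j \<in> {1..<k}. inf (d j - x j) (x (j + 1)) = 0)}"

definition EHE :: "nat \<Rightarrow> nat \<Rightarrow> (nat \<Rightarrow> 'n::finite tensor) \<Rightarrow> bool" where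
  "EHE m k A \<longleftrightarrow>
     (\<forall>x \<in> {0..k} \<rightarrow>\<^sub>E UNIV.
        tensor_apply m (A 0) (x 0) = (\<Sum>j = 1..k. tensor_apply m (A j) (x j)) \<and>
        (\<forall>i \<in> {1..k}. 0 \<le> x i) \<and> (\<forall>i \<in> {1..k}. x 0 * x i \<le> 0)
        \<longleftrightarrow> (\<forall>i \<in> {0..k}. x i = 0))"

end

theory Submission
  imports Defs "HOL-Library.Z2"
begin

text \<open>
  Boundedness of the solution sets comes from homogeneity. The equation and sign conditions that
  define an EHE tensor describe the zeros of a positively homogeneous map on a closed cone. As the
  origin is the only zero, compactness of the unit sphere of the cone bounds the norm of the map
  from below by a multiple of the power \<open>m - 1\<close> of the norm of the tuple (\<open>EHE_coercive\<close>). Solutions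
  of the complementarity system lie in this cone, so they are bounded; they form a closed set, hence
  a compact one.

  For existence, note that in each coordinate the complementarity conditions force
  \<open>(x\<^sub>0, \<dots>, x\<^sub>k)\<close> onto a piecewise linear curve: one first moves along \<open>x\<^sub>0\<close> down to \<open>0\<close>, then along
  \<open>x\<^sub>1\<close> up to \<open>d\<^sub>1\<close>, then along \<open>x\<^sub>2\<close>, and so on. With one real parameter per coordinate, a solution is
  a zero of a continuous map from \<open>\<real>\<^sup>n\<close> to itself. The definition of EHE allows \<open>x\<^sub>0\<close> to be
  negative, so the curve can be contracted inside the cone to the line \<open>x\<^sub>0 = - t\<close>, \<open>x\<^sub>j = 0\<close>, on which
  the map is \<open>\<A>\<^sub>0 (- t)\<^sup>m\<^sup>-\<^sup>1\<close>; this is odd because \<open>m\<close> is even. Let the stage of the contraction depend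
  on the norm of \<open>t\<close>, so that it is complete on the boundary of a large cube. By coercivity no zero
  occurs in the region where the contraction is under way, so any zero in the cube is a solution,
  and a zero exists by Borsuk's theorem: a continuous map from a cube in \<open>\<real>\<^sup>n\<close> to \<open>\<real>\<^sup>n\<close> that is odd on
  the boundary has a zero (\<open>odd_on_cube_boundary_has_zero\<close>).

  Borsuk's theorem is proved by a parity argument on the cells of a cubical grid. Let \<open>s\<^sub>d\<close> record the
  sign of the \<open>d\<close>-th component of the map at the cell centres, as an element of the field with two
  elements. Put \<open>T\<^sub>0 = 1\<close> and \<open>T\<^sub>d\<^sub>+\<^sub>1 = \<delta>(s\<^sub>d T\<^sub>d)\<close> with the cubical coboundary \<open>\<delta>\<close>. If the
  signs \<open>s\<^sub>d\<close> are antipodal on the boundary, the values of \<open>T\<^sub>n\<close> on the top-dimensional cells add up to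
  \<open>1\<close> (\<open>sum_sign_cochain_cube\<close>), so some cell has \<open>T\<^sub>n \<noteq> 0\<close>; on such a cell every component changes
  sign (\<open>sign_cochain_nonzero_imp_sign_change\<close>). Refining the grid produces points at which the map is
  arbitrarily small.
\<close>

section \<open>Mod 2 cochains on a cubical grid\<close>

text \<open>
  The simplifier is kept from rewriting the field operations on bits into Boolean operations, so
  that the usual laws for sums stay applicable.
\<close>

declare add_bit_eq_xor [simp del] mult_bit_eq_and [simp del]
  bit_not_zero_iff [simp del] bit_not_one_iff [simp del]

lemma bit_add_self [simp]: "a + a = (0 :: bit)" and bit_add_self_left [simp]: "a + (a + b) = (b :: bit)"
proof -
  show "a + a = 0" by (cases a) simp_all
  then show "a + (a + b) = b" by (simp flip: add.assoc)
qed

lemma sum_symmetric_off_diagonal: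
  fixes G :: "'a \<Rightarrow> 'a \<Rightarrow> bit"
  assumes "finite S" "\<And>i j. i \<in> S \<Longrightarrow> j \<in> S \<Longrightarrow> i \<noteq> j \<Longrightarrow> G i j = G j i"
  shows "(\<Sum>i\<in>S. \<Sum>j\<in>S - {i}. G i j) = 0"
  using assms
proof (induction S rule: finite_induct)
  case empty
  then show ?case by simp
next
  case (insert x S)
  have "(\<Sum>j\<in>insert x S - {i}. G i j) = G i x + (\<Sum>j\<in>S - {i}. G i j)" if "i \<in> S" for i
  proof -
    have "insert x S - {i} = insert x (S - {i})" using that insert.hyps by auto
    then show ?thesis using insert.hyps by simp
  qed
  moreover have "(\<Sum>j\<in>insert x S - {x}. G x j) = (\<Sum>j\<in>S. G j x)"
    using insert.hyps insert.prems by (intro sum.cong) auto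
  ultimately show ?case
    using insert by (simp add: sum.distrib)
qed

text \<open>
  A cell of the grid is a point of the integer lattice: an even coordinate is a vertex of the
  one-dimensional grid, an odd coordinate is the open edge between its two even neighbours. So the
  dimension of a cell is its number of odd coordinates, its facets arise by moving one odd coordinate
  to a neighbour, and the antipodal map is negation. Only the coordinates below \<open>n\<close> count.
\<close>

definition coboundary :: "nat \<Rightarrow> ((nat \<Rightarrow> int) \<Rightarrow> bit) \<Rightarrow> (nat \<Rightarrow> int) \<Rightarrow> bit" where
  "coboundary n \<phi> c = (\<Sum>i | i < n \<and> odd (c i). \<phi> (c(i := c i + 1)) + \<phi> (c(i := c i - 1)))"

text \<open>
  A face of codimension two is reached by altering two odd coordinates in either order, so each one is
  counted twice.
\<close>

lemma coboundary_coboundary: "coboundary n (coboundary n \<phi>) c = 0"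
proof -
  let ?S = "{i. i < n \<and> odd (c i)}"
  let ?G = "\<lambda>i j. (\<phi> (c(i := c i + 1, j := c j + 1)) + \<phi> (c(i := c i + 1, j := c j - 1)))
                + (\<phi> (c(i := c i - 1, j := c j + 1)) + \<phi> (c(i := c i - 1, j := c j - 1)))"
  have *: "coboundary n \<phi> (c(i := x)) = (\<Sum>j\<in>?S - {i}. \<phi> (c(i := x, j := c j + 1)) + \<phi> (c(i := x, j := c j - 1)))"
    if "even x" for i x
  proof -
    have "{j. j < n \<and> odd ((c(i := x)) j)} = ?S - {i}" using that by auto
    then show ?thesis unfolding coboundary_def by (intro sum.cong) auto
  qed
  have "coboundary n (coboundary n \<phi>) c = (\<Sum>i\<in>?S. \<Sum>j\<in>?S - {i}. ?G i j)"
    unfolding coboundary_def[of n "coboundary n \<phi>"]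
    by (rule sum.cong) (auto simp: * simp flip: sum.distrib)
  also have "\<dots> = 0"
    by (rule sum_symmetric_off_diagonal) (auto simp: fun_upd_twist add_ac)
  finally show ?thesis .
qed

text \<open>
  The product of the coboundaries \<open>\<delta>s\<^sub>0, \<dots>, \<delta>s\<^sub>d\<^sub>-\<^sub>1\<close>, written so that it makes sense directly on
  cubical cells: \<open>T\<^sub>d c\<close> is the sum, over all flags of faces descending from \<open>c\<close>, of the product of
  the changes of \<open>s\<^sub>j\<close> along the flag. If \<open>s\<close> is antipodal on the boundary sphere
  of the cube, \<open>T\<^sub>d\<close> represents there the \<open>d\<close>-th power of the generating class of degree one of
  projective space.
\<close>

primrec sign_cochain :: "(nat \<Rightarrow> (nat \<Rightarrow> int) \<Rightarrow> bit) \<Rightarrow> nat \<Rightarrow> nat \<Rightarrow> (nat \<Rightarrow> int) \<Rightarrow> bit" where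
  "sign_cochain s n 0 = (\<lambda>c. 1)"
| "sign_cochain s n (Suc d) = coboundary n (\<lambda>c. s d c * sign_cochain s n d c)"

lemma coboundary_sign_cochain: "coboundary n (sign_cochain s n d) c = 0"
proof (cases d)
  case 0
  then show ?thesis by (simp add: coboundary_def)
next
  case (Suc e)
  then show ?thesis by (simp add: coboundary_coboundary)
qed

definition on_boundary :: "int \<Rightarrow> nat \<Rightarrow> (nat \<Rightarrow> int) \<Rightarrow> bool" where
  "on_boundary M n c \<longleftrightarrow> (\<forall>i. \<bar>c i\<bar> \<le> M) \<and> (\<exists>i<n. \<bar>c i\<bar> = M)"

lemma on_boundary_facet:
  assumes "even M" "on_boundary M n c" "odd (c i)" "\<bar>x - c i\<bar> \<le> 1"
  shows "on_boundary M n (c(i := x))"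
proof -
  obtain j where "j < n" "\<bar>c j\<bar> = M" using assms by (auto simp: on_boundary_def)
  moreover have "\<bar>x\<bar> \<le> M"
  proof -
    have "\<bar>c i\<bar> \<noteq> M" using assms by (metis even_abs_add_iff abs_abs even_add dvd_abs_iff)
    then show ?thesis using assms(2,4) unfolding on_boundary_def by (smt (verit))
  qed
  moreover have "j \<noteq> i" using assms calculation by auto
  ultimately show ?thesis using assms by (auto simp: on_boundary_def)
qed

text \<open>
  On a boundary cell \<open>s\<^sub>d T\<^sub>d\<close> changes by \<open>T\<^sub>d\<close> under negation, and \<open>\<delta>T\<^sub>d = 0\<close>, so that the
  coboundary does not change.
\<close>

lemma sign_cochain_antipodal:
  assumes M: "even M" and s: "\<And>d c. on_boundary M n c \<Longrightarrow> s d (- c) = s d c + 1"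
  shows "on_boundary M n c \<Longrightarrow> sign_cochain s n d (- c) = sign_cochain s n d c"
proof (induction d arbitrary: c)
  case (Suc d)
  let ?\<phi> = "\<lambda>c. s d c * sign_cochain s n d c"
  have phi: "?\<phi> (- f) = ?\<phi> f + sign_cochain s n d f" if "on_boundary M n f" for f
    by (simp only: s[OF that] Suc.IH[OF that] distrib_right mult_1_left)
  have upd: "(- c)(i := - x) = - (c(i := x))" for i x by (auto simp: fun_eq_iff)
  have "coboundary n ?\<phi> (- c) = (\<Sum>i | i < n \<and> odd (c i). ?\<phi> (- (c(i := c i - 1))) + ?\<phi> (- (c(i := c i + 1))))"
    unfolding coboundary_def by (rule sum.cong) (simp_all flip: upd)
  also have "\<dots> = (\<Sum>i | i < n \<and> odd (c i).
      (?\<phi> (c(i := c i + 1)) + ?\<phi> (c(i := c i - 1)))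
      + (sign_cochain s n d (c(i := c i + 1)) + sign_cochain s n d (c(i := c i - 1))))"
  proof (rule sum.cong, goal_cases)
    case (2 i)
    then have "on_boundary M n (c(i := c i - 1))" "on_boundary M n (c(i := c i + 1))"
      using on_boundary_facet[OF M Suc.prems] by auto
    then show ?case by (simp only: phi add_ac)
  qed simp
  also have "\<dots> = coboundary n ?\<phi> c + coboundary n (sign_cochain s n d) c"
    unfolding coboundary_def by (rule sum.distrib)
  finally show ?case by (simp only: coboundary_sign_cochain add_0_right sign_cochain.simps)
qed simp

section \<open>Stokes formula on boxes and the parity count\<close>

definition odds :: "int \<Rightarrow> int \<Rightarrow> int set" where
  "odds a b = {x. a < x \<and> x < b \<and> odd x}"

lemma finite_odds [simp]: "finite (odds a b)"
  by (rule finite_subset[of _ "{a..b}"]) (auto simp: odds_def)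

lemma sum_odds_telescope:
  fixes g :: "int \<Rightarrow> bit"
  assumes "even a" "even b" "a \<le> b"
  shows "(\<Sum>x\<in>odds a b. g (x + 1) + g (x - 1)) = g b + g a"
proof -
  have "(\<Sum>x\<in>odds a (a + 2 * int k). g (x + 1) + g (x - 1)) = g (a + 2 * int k) + g a" for k
  proof (induction k)
    case 0
    have "odds a a = {}" by (auto simp: odds_def)
    then show ?case by simp
  next
    case (Suc k)
    let ?b = "a + 2 * int k"
    have "odds a (a + 2 * int (Suc k)) = insert (?b + 1) (odds a ?b)"
    proof (intro set_eqI iffI)
      fix x assume x: "x \<in> odds a (a + 2 * int (Suc k))"
      then have "x \<noteq> ?b" using assms(1) by (auto simp: odds_def)
      then show "x \<in> insert (?b + 1) (odds a ?b)" using x by (auto simp: odds_def)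
    qed (use assms(1) in \<open>auto simp: odds_def\<close>)
    moreover have "?b + 1 \<notin> odds a ?b" by (simp add: odds_def)
    ultimately show ?case using Suc.IH by (simp add: add_ac flip: add.assoc)
  qed
  moreover obtain k where "b = a + 2 * int k"
  proof -
    obtain l where "b - a = 2 * l" using assms by (meson dvd_def dvd_diff)
    then show thesis using that[of "nat l"] assms(3) by simp
  qed
  ultimately show ?thesis by simp
qed

definition box_cells :: "(nat \<Rightarrow> int) \<Rightarrow> (nat \<Rightarrow> int) \<Rightarrow> nat set \<Rightarrow> (nat \<Rightarrow> int) set" where
  "box_cells lo hi D = {c. (\<forall>i\<in>D. c i \<in> odds (lo i) (hi i)) \<and> (\<forall>i. i \<notin> D \<longrightarrow> c i = 0)}"

lemma box_cells_mono:
  assumes "\<And>i. lo' i \<le> lo i" "\<And>i. hi i \<le> hi' i"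
  shows "box_cells lo hi D \<subseteq> box_cells lo' hi' D"
proof -
  have "odds (lo i) (hi i) \<subseteq> odds (lo' i) (hi' i)" for i
    using assms(1,2)[of i] by (auto simp: odds_def)
  then show ?thesis by (auto simp: box_cells_def)
qed

lemma sum_box_cells_coordinate:
  fixes G :: "(nat \<Rightarrow> int) \<Rightarrow> bit"
  assumes "i \<in> D"
  shows "(\<Sum>c\<in>box_cells lo hi D. G c) =
         (\<Sum>c\<in>box_cells lo hi (D - {i}). \<Sum>x\<in>odds (lo i) (hi i). G (c(i := x)))"
proof -
  have "(\<Sum>c\<in>box_cells lo hi D. G c) =
        (\<Sum>(c, x)\<in>box_cells lo hi (D - {i}) \<times> odds (lo i) (hi i). G (c(i := x)))"
    by (rule sum.reindex_bij_witness[of _ "\<lambda>(c, x). c(i := x)" "\<lambda>c. (c(i := 0), c i)"])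
       (use assms in \<open>auto simp: box_cells_def fun_eq_iff split: if_splits\<close>)
  then show ?thesis by (simp add: sum.cartesian_product)
qed

text \<open>
  Stokes' formula modulo 2: the contributions of interior facets cancel in pairs, along each
  coordinate separately.
\<close>

lemma sum_coboundary_box_cells:
  assumes D: "D \<subseteq> {..<n}" and even: "\<And>i. even (lo i)" "\<And>i. even (hi i)" and le: "\<And>i. lo i \<le> hi i"
  shows "(\<Sum>c\<in>box_cells lo hi D. coboundary n \<phi> c) =
         (\<Sum>i\<in>D. \<Sum>c\<in>box_cells lo hi (D - {i}). \<phi> (c(i := hi i)) + \<phi> (c(i := lo i)))"
proof -
  have "(\<Sum>c\<in>box_cells lo hi D. coboundary n \<phi> c) =
        (\<Sum>c\<in>box_cells lo hi D. \<Sum>i\<in>D. \<phi> (c(i := c i + 1)) + \<phi> (c(i := c i - 1)))"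
  proof (rule sum.cong)
    fix c assume c: "c \<in> box_cells lo hi D"
    have "odd (c i) \<longleftrightarrow> i \<in> D" for i
      using c by (cases "i \<in> D") (auto simp: box_cells_def odds_def)
    then have "{i. i < n \<and> odd (c i)} = D" using D by auto
    then show "coboundary n \<phi> c = (\<Sum>i\<in>D. \<phi> (c(i := c i + 1)) + \<phi> (c(i := c i - 1)))"
      by (simp add: coboundary_def)
  qed simp
  also have "\<dots> = (\<Sum>i\<in>D. \<Sum>c\<in>box_cells lo hi D. \<phi> (c(i := c i + 1)) + \<phi> (c(i := c i - 1)))"
    by (rule sum.swap)
  also have "\<dots> = (\<Sum>i\<in>D. \<Sum>c\<in>box_cells lo hi (D - {i}). \<phi> (c(i := hi i)) + \<phi> (c(i := lo i)))"
    by (rule sum.cong[OF refl], subst sum_box_cells_coordinate, assumption)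
       (auto intro!: sum.cong sum_odds_telescope simp: even le)
  finally show ?thesis .
qed

lemma sum_box_cells_uminus:
  fixes G :: "(nat \<Rightarrow> int) \<Rightarrow> bit"
  shows "(\<Sum>c\<in>box_cells (\<lambda>_. - M) (\<lambda>_. M) D. G (- c)) = (\<Sum>c\<in>box_cells (\<lambda>_. - M) (\<lambda>_. M) D. G c)"
  by (rule sum.reindex_bij_witness[of _ uminus uminus])
     (force simp: box_cells_def odds_def)+

lemma finite_box_cells: assumes "finite D" shows "finite (box_cells lo hi D)"
proof -
  have "box_cells lo hi D \<subseteq> {f. \<forall>x. (x \<in> D \<longrightarrow> f x \<in> (\<Union>i\<in>D. odds (lo i) (hi i))) \<and> (x \<notin> D \<longrightarrow> f x = 0)}"
    by (auto simp: box_cells_def)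
  then show ?thesis
    by (rule finite_subset) (use assms in \<open>intro finite_set_of_finite_funs, auto\<close>)
qed

text \<open>
  An odd coordinate is never \<open>0\<close>, so the hyperplane where coordinate \<open>d\<close> vanishes splits a symmetric
  box into two halves that negation exchanges.
\<close>

lemma sum_box_cells_halves:
  fixes G :: "(nat \<Rightarrow> int) \<Rightarrow> bit"
  assumes D: "d \<in> D" "finite D" and M: "M \<ge> 0"
  defines "H \<equiv> box_cells ((\<lambda>_. - M)(d := 0)) (\<lambda>_. M) D"
  shows "(\<Sum>c\<in>box_cells (\<lambda>_. - M) (\<lambda>_. M) D. G c) = (\<Sum>c\<in>H. G c + G (- c))"
proof -
  have fin: "finite H" unfolding H_def by (rule finite_box_cells[OF D(2)])
  have neg: "x \<in> odds (- M) M \<longleftrightarrow> - x \<in> odds (- M) M" for x by (auto simp: odds_def)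
  have "box_cells (\<lambda>_. - M) (\<lambda>_. M) D = H \<union> uminus ` H"
  proof (intro set_eqI iffI)
    fix c assume c: "c \<in> box_cells (\<lambda>_. - M) (\<lambda>_. M) D"
    then have "odd (c d)" using D by (auto simp: box_cells_def odds_def)
    then have "c d \<noteq> 0" by auto
    then consider "c d > 0" | "c d < 0" by linarith
    then show "c \<in> H \<union> uminus ` H"
    proof cases
      case 1
      then show ?thesis using c by (auto simp: box_cells_def odds_def H_def)
    next
      case 2
      then have "- c \<in> H" using c by (force simp: box_cells_def odds_def H_def)
      then have "- (- c) \<in> uminus ` H" by (rule imageI)
      moreover have "- (- c) = c" by (simp add: fun_eq_iff)
      ultimately show ?thesis by simp
    qed
  next
    fix c assume "c \<in> H \<union> uminus ` H"
    moreover have "H \<subseteq> box_cells (\<lambda>_. - M) (\<lambda>_. M) D"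
      unfolding H_def by (rule box_cells_mono) (use M in auto)
    moreover have "- c \<in> box_cells (\<lambda>_. - M) (\<lambda>_. M) D" if "c \<in> box_cells (\<lambda>_. - M) (\<lambda>_. M) D" for c
      using that neg by (force simp: box_cells_def)
    ultimately show "c \<in> box_cells (\<lambda>_. - M) (\<lambda>_. M) D" by auto
  qed
  moreover have "H \<inter> uminus ` H = {}"
  proof -
    have "c d > 0" if "c \<in> H" for c using that D by (auto simp: H_def box_cells_def odds_def)
    then have "- c \<notin> H" if "c \<in> H" for c
      using that by (metis fun_Compl_def less_asym neg_0_less_iff_less)
    then show ?thesis by auto
  qed
  ultimately have "(\<Sum>c\<in>box_cells (\<lambda>_. - M) (\<lambda>_. M) D. G c) = (\<Sum>c\<in>H. G c) + (\<Sum>c\<in>uminus ` H. G c)"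
    using fin by (simp add: sum.union_disjoint)
  also have "(\<Sum>c\<in>uminus ` H. G c) = (\<Sum>c\<in>H. G (- c))"
    by (subst sum.reindex) (auto intro!: inj_onI simp: fun_eq_iff)
  finally show ?thesis by (simp add: sum.distrib)
qed

text \<open>
  Write \<open>I\<close> for the interval from \<open>- M\<close> to \<open>M\<close>. By Stokes' formula the sum of \<open>T\<^sub>d\<^sub>+\<^sub>1\<close> over the cube
  \<open>I\<^sup>d\<^sup>+\<^sup>1\<close> is the sum of \<open>s\<^sub>d T\<^sub>d\<close> over its boundary. Opposite facets are exchanged by negation, which
  adds \<open>T\<^sub>d\<close>, so what remains is the sum of \<open>T\<^sub>d\<close> over the facets on the positive side. By symmetry the
  positive side facets may be replaced by the upper halves of all side facets. Together with the top
  facet they form the boundary of the half cube \<open>I\<^sup>d \<times> [0, M]\<close> without its bottom \<open>I\<^sup>d \<times> {0}\<close>, so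
  the cocycle property moves the sum to \<open>I\<^sup>d\<close>, one dimension lower.
\<close>

lemma sum_sign_cochain_cube:
  assumes M: "even M" "M > 0" and s: "\<And>d c. on_boundary M n c \<Longrightarrow> s d (- c) = s d c + 1"
  shows "d \<le> n \<Longrightarrow> (\<Sum>c\<in>box_cells (\<lambda>_. - M) (\<lambda>_. M) {..<d}. sign_cochain s n d c) = 1"
proof (induction d)
  case 0
  have "box_cells (\<lambda>_. - M) (\<lambda>_. M) {..<0} = {\<lambda>_. 0}" by (auto simp: box_cells_def)
  then show ?case by simp
next
  case (Suc d)
  let ?B = "box_cells (\<lambda>_. - M) (\<lambda>_. M)"
  let ?lo = "(\<lambda>_. - M)(d := 0)"
  let ?H = "box_cells ?lo (\<lambda>_. M)"
  let ?T = "sign_cochain s n d"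
  let ?\<phi> = "\<lambda>c. s d c * ?T c"
  let ?D = "\<lambda>i. {..<Suc d} - {i}"
  have anti: "?T (- c) = ?T c" if "on_boundary M n c" for c
    by (rule sign_cochain_antipodal) (use M s that in auto)
  have bd: "on_boundary M n (c(i := x))" if "c \<in> ?B (?D i)" "i \<le> d" "\<bar>x\<bar> = M" for c i x
    unfolding on_boundary_def
  proof (intro conjI allI)
    fix j show "\<bar>(c(i := x)) j\<bar> \<le> M"
    proof (cases "j \<in> ?D i")
      case True
      then have "c j \<in> odds (- M) M" using that(1) unfolding box_cells_def by blast
      then show ?thesis using True by (auto simp: odds_def)
    next
      case False
      then have "c j = 0" using that(1) unfolding box_cells_def by blast
      then show ?thesis using that M by auto
    qed
  next
    show "\<exists>j<n. \<bar>(c(i := x)) j\<bar> = M"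
      using that Suc.prems by (intro exI[of _ i]) simp
  qed
  have upd: "- (c(i := x)) = (- c)(i := - x)" for c :: "nat \<Rightarrow> int" and i x
    by (auto simp: fun_eq_iff)
  have D0: "?D d = {..<d}" by auto
  have H0: "?H {..<d} = ?B {..<d}" by (auto simp: box_cells_def)
  have "(\<Sum>c\<in>?B {..<Suc d}. sign_cochain s n (Suc d) c) =
        (\<Sum>i<Suc d. \<Sum>c\<in>?B (?D i). ?\<phi> (c(i := M)) + ?\<phi> (c(i := - M)))"
    using sum_coboundary_box_cells[of "{..<Suc d}" n "\<lambda>_. - M" "\<lambda>_. M" ?\<phi>] Suc.prems M by simp
  \<comment> \<open>Pair each facet with its antipode.\<close>
  also have "\<dots> = (\<Sum>i<Suc d. \<Sum>c\<in>?B (?D i). ?T (c(i := M)))"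
  proof (rule sum.cong[OF refl])
    fix i assume i: "i \<in> {..<Suc d}"
    have "(\<Sum>c\<in>?B (?D i). ?\<phi> (c(i := - M))) = (\<Sum>c\<in>?B (?D i). ?\<phi> ((- c)(i := - M)))"
      by (rule sum_box_cells_uminus[symmetric])
    also have "\<dots> = (\<Sum>c\<in>?B (?D i). ?\<phi> (- (c(i := M))))"
      by (simp only: upd)
    also have "\<dots> = (\<Sum>c\<in>?B (?D i). ?\<phi> (c(i := M)) + ?T (c(i := M)))"
    proof (rule sum.cong[OF refl])
      fix c assume "c \<in> ?B (?D i)"
      then have "on_boundary M n (c(i := M))" using bd i M by auto
      then show "?\<phi> (- (c(i := M))) = ?\<phi> (c(i := M)) + ?T (c(i := M))"
        by (simp only: s anti distrib_right mult_1_left)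
    qed
    finally show "(\<Sum>c\<in>?B (?D i). ?\<phi> (c(i := M)) + ?\<phi> (c(i := - M))) = (\<Sum>c\<in>?B (?D i). ?T (c(i := M)))"
      by (simp add: sum.distrib flip: add.assoc)
  qed
  also have "\<dots> = (\<Sum>i<d. \<Sum>c\<in>?B (?D i). ?T (c(i := M))) + (\<Sum>c\<in>?B {..<d}. ?T (c(d := M)))"
    by (simp add: D0)
  \<comment> \<open>The lower half of a positive side facet is the antipode of the upper half of the negative one.\<close>
  also have "(\<Sum>i<d. \<Sum>c\<in>?B (?D i). ?T (c(i := M))) =
             (\<Sum>i<d. \<Sum>c\<in>?H (?D i). ?T (c(i := M)) + ?T (c(i := - M)))"
  proof (rule sum.cong[OF refl])
    fix i assume i: "i \<in> {..<d}"
    have "(\<Sum>c\<in>?B (?D i). ?T (c(i := M))) = (\<Sum>c\<in>?H (?D i). ?T (c(i := M)) + ?T ((- c)(i := M)))"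
      by (rule sum_box_cells_halves) (use i M in auto)
    also have "\<dots> = (\<Sum>c\<in>?H (?D i). ?T (c(i := M)) + ?T (c(i := - M)))"
    proof (rule sum.cong[OF refl])
      fix c assume "c \<in> ?H (?D i)"
      moreover have "?H (?D i) \<subseteq> ?B (?D i)" by (rule box_cells_mono) (use M in auto)
      ultimately have "c \<in> ?B (?D i)" by blast
      then have "on_boundary M n (c(i := - M))" using bd i M by auto
      from anti[OF this] show "?T (c(i := M)) + ?T ((- c)(i := M)) = ?T (c(i := M)) + ?T (c(i := - M))"
        by (simp add: upd)
    qed
    finally show "(\<Sum>c\<in>?B (?D i). ?T (c(i := M))) = (\<Sum>c\<in>?H (?D i). ?T (c(i := M)) + ?T (c(i := - M)))" .
  qed
  finally have S: "(\<Sum>c\<in>?B {..<Suc d}. sign_cochain s n (Suc d) c) =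
      (\<Sum>i<d. \<Sum>c\<in>?H (?D i). ?T (c(i := M)) + ?T (c(i := - M))) + (\<Sum>c\<in>?B {..<d}. ?T (c(d := M)))" .
  \<comment> \<open>Apply Stokes' formula to the cocycle on the half cube.\<close>
  have "0 = (\<Sum>c\<in>?H {..<Suc d}. coboundary n ?T c)"
    by (simp add: coboundary_sign_cochain)
  also have "\<dots> = (\<Sum>i<Suc d. \<Sum>c\<in>?H (?D i). ?T (c(i := M)) + ?T (c(i := ?lo i)))"
    by (rule sum_coboundary_box_cells) (use Suc.prems M in auto)
  also have "\<dots> = (\<Sum>i<d. \<Sum>c\<in>?H (?D i). ?T (c(i := M)) + ?T (c(i := - M)))
                + (\<Sum>c\<in>?B {..<d}. ?T (c(d := M)) + ?T (c(d := 0)))"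
    by (simp add: D0 H0)
  also have "(\<Sum>c\<in>?B {..<d}. ?T (c(d := M)) + ?T (c(d := 0))) =
             (\<Sum>c\<in>?B {..<d}. ?T (c(d := M))) + (\<Sum>c\<in>?B {..<d}. ?T c)"
  proof -
    have "c(d := 0) = c" if "c \<in> ?B {..<d}" for c
      using that by (auto simp: box_cells_def fun_eq_iff)
    then show ?thesis by (simp add: sum.distrib)
  qed
  finally have zero: "0 = (\<Sum>i<d. \<Sum>c\<in>?H (?D i). ?T (c(i := M)) + ?T (c(i := - M))) +
      ((\<Sum>c\<in>?B {..<d}. ?T (c(d := M))) + (\<Sum>c\<in>?B {..<d}. ?T c))" .
  have cancel: "x + y = z" if "0 = x + (y + z)" for x y z :: bit
    using that by (cases x; cases y; cases z) simp_all
  show ?case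
    unfolding S using cancel[OF zero] Suc.IH[OF Suc_leD[OF Suc.prems]] by (rule trans)
qed

definition face :: "(nat \<Rightarrow> int) \<Rightarrow> (nat \<Rightarrow> int) \<Rightarrow> bool" where
  "face f c \<longleftrightarrow> (\<forall>i. f i = c i \<or> odd (c i) \<and> \<bar>f i - c i\<bar> = 1)"

lemma face_trans: assumes "face e f" "face f c" shows "face e c"
  unfolding face_def
proof
  fix i
  have "even (f i)" if "odd (c i)" "\<bar>f i - c i\<bar> = 1"
  proof -
    have "f i = c i + 1 \<or> f i = c i - 1" using that by linarith
    then show ?thesis using that by auto
  qed
  then show "e i = c i \<or> odd (c i) \<and> \<bar>e i - c i\<bar> = 1"
    using assms unfolding face_def by metis
qed

text \<open>
  If \<open>s\<^sub>d\<close> had a constant value \<open>k\<close> on the facets of \<open>c\<close>, then \<open>T\<^sub>d\<^sub>+\<^sub>1 c\<close> would be \<open>k\<close> times the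
  coboundary of \<open>T\<^sub>d\<close>, which vanishes. The lower signs are found on a facet where \<open>T\<^sub>d\<close> does not vanish.
\<close>

lemma sign_cochain_nonzero_imp_sign_change:
  assumes "sign_cochain s n d c \<noteq> 0" "j < d"
  shows "\<exists>f g. face f c \<and> face g c \<and> s j f \<noteq> s j g"
  using assms
proof (induction d arbitrary: c)
  case (Suc d)
  let ?I = "{i. i < n \<and> odd (c i)}"
  let ?F = "{f. \<exists>i\<in>?I. f = c(i := c i + 1) \<or> f = c(i := c i - 1)}"
  have face: "face f c" if "f \<in> ?F" for f using that by (auto simp: face_def split: if_splits)
  show ?case
  proof (cases "j = d")
    case True
    show ?thesis
    proof (rule ccontr)
      assume no: "\<not> ?thesis"
      then obtain k where k: "\<And>f. f \<in> ?F \<Longrightarrow> s d f = k"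
        using face True by (metis (no_types, lifting))
      have "sign_cochain s n (Suc d) c = (\<Sum>i\<in>?I. k * (sign_cochain s n d (c(i := c i + 1)) + sign_cochain s n d (c(i := c i - 1))))"
        unfolding sign_cochain.simps coboundary_def
      proof (rule sum.cong[OF refl])
        fix i assume "i \<in> ?I"
        then have "s d (c(i := c i + 1)) = k" "s d (c(i := c i - 1)) = k" by (auto intro!: k)
        then show "s d (c(i := c i + 1)) * sign_cochain s n d (c(i := c i + 1)) + s d (c(i := c i - 1)) * sign_cochain s n d (c(i := c i - 1))
          = k * (sign_cochain s n d (c(i := c i + 1)) + sign_cochain s n d (c(i := c i - 1)))"
          by (simp only: distrib_left)
      qed
      also have "\<dots> = k * coboundary n (sign_cochain s n d) c"
        by (simp only: coboundary_def sum_distrib_left)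
      finally show False using Suc.prems by (simp add: coboundary_sign_cochain del: sign_cochain.simps)
    qed
  next
    case False
    have "\<exists>f\<in>?F. sign_cochain s n d f \<noteq> 0"
    proof (rule ccontr)
      assume no: "\<not> ?thesis"
      have "sign_cochain s n d (c(i := c i + 1)) = 0" "sign_cochain s n d (c(i := c i - 1)) = 0" if "i \<in> ?I" for i
        using that no by blast+
      then have "sign_cochain s n (Suc d) c = 0" by (simp add: coboundary_def)
      then show False using Suc.prems by simp
    qed
    then obtain f where f: "f \<in> ?F" "sign_cochain s n d f \<noteq> 0" by blast
    have "j < d" using False Suc.prems by simp
    from Suc.IH[OF f(2) this] obtain g h where "face g f" "face h f" "s j g \<noteq> s j h" by blast
    then show ?thesis using face_trans[OF _ face[OF f(1)]] by blast
  qed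
qed simp

section \<open>Borsuk's theorem for cubes\<close>

text \<open>
  If there were no zero, the map would be bounded away from \<open>0\<close>. On a grid that is fine enough, the
  parity count gives a cell on which every component changes sign, and all components are small there.
\<close>

theorem odd_on_cube_boundary_has_zero:
  fixes f :: "real^'n \<Rightarrow> real^'n"
  assumes r: "r > 0" and cont: "continuous_on {x. \<forall>i. \<bar>x $ i\<bar> \<le> r} f"
    and odd: "\<And>x i. (\<forall>j. \<bar>x $ j\<bar> \<le> r) \<Longrightarrow> \<bar>x $ i\<bar> = r \<Longrightarrow> f (- x) = - f x"
  shows "\<exists>x. (\<forall>i. \<bar>x $ i\<bar> \<le> r) \<and> f x = 0"
proof (rule ccontr)
  assume no_zero: "\<not> ?thesis"
  define Q where "Q = {x :: real^'n. \<forall>i. \<bar>x $ i\<bar> \<le> r}"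
  note cont = cont[folded Q_def]
  have nz: "f x \<noteq> 0" if "x \<in> Q" for x
    using that no_zero by (auto simp: Q_def)
  have "Q = cbox (\<chi> i. - r) (\<chi> i. r)"
    by (auto simp: Q_def mem_box_cart abs_le_iff) (metis minus_le_iff)+
  then have "compact Q" by simp
  have "0 \<in> Q" using r by (simp add: Q_def)
  obtain x0 where "x0 \<in> Q" "\<And>x. x \<in> Q \<Longrightarrow> norm (f x0) \<le> norm (f x)"
    using continuous_attains_inf[OF \<open>compact Q\<close>, of "\<lambda>x. norm (f x)"] \<open>0 \<in> Q\<close> cont
    by (auto intro: continuous_intros)
  define \<epsilon> where "\<epsilon> = norm (f x0)"
  have \<epsilon>: "\<epsilon> > 0" "\<And>x. x \<in> Q \<Longrightarrow> \<epsilon> \<le> norm (f x)"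
    using \<open>x0 \<in> Q\<close> nz \<open>\<And>x. x \<in> Q \<Longrightarrow> norm (f x0) \<le> norm (f x)\<close> by (auto simp: \<epsilon>_def)
  define n where "n = CARD('n)"
  have n: "n > 0" by (simp add: n_def)
  have "uniformly_continuous_on Q f"
    by (rule compact_uniformly_continuous[OF cont \<open>compact Q\<close>])
  then obtain \<delta> where \<delta>: "\<delta> > 0" "\<And>x y. x \<in> Q \<Longrightarrow> y \<in> Q \<Longrightarrow> dist y x < \<delta> \<Longrightarrow> dist (f y) (f x) < \<epsilon> / n"
    using \<epsilon>(1) n unfolding uniformly_continuous_on_def by (metis divide_pos_pos of_nat_0_less_iff)
  obtain N :: nat where N: "n * r / \<delta> < N" using reals_Archimedean2 by blast
  have "0 < n * r / \<delta>" using n r \<delta> by simp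
  with N have "N > 0" by (metis less_trans of_nat_0_less_iff)
  define M where "M = 2 * int N"
  have M: "even M" "M > 0" using \<open>N > 0\<close> by (auto simp: M_def)
  obtain e :: "'n \<Rightarrow> nat" where e: "bij_betw e UNIV {..<n}"
    unfolding n_def by (metis bij_betw_iff_card card_lessThan finite finite_lessThan)
  define e' where "e' = inv_into UNIV e"
  have e': "e' (e i) = i" for i
    unfolding e'_def using e by (metis bij_betw_def inv_into_f_f UNIV_I)
  have en: "e i < n" for i using e by (auto simp: bij_betw_def)
  \<comment> \<open>The centre of a cell, scaled so that the cells between \<open>- M\<close> and \<open>M\<close> fill the given cube.\<close>
  define p :: "(nat \<Rightarrow> int) \<Rightarrow> real^'n" where "p c = (\<chi> i. r * of_int (c (e i)) / of_int M)" for c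
  have p_minus: "p (- c) = - p c" for c by (simp add: p_def vec_eq_iff)
  have p_abs: "\<bar>p c $ i\<bar> = r * of_int \<bar>c (e i)\<bar> / of_int M" for c i
    using r M by (simp add: p_def abs_mult)
  have p_Q: "p c \<in> Q" if "\<And>i. i < n \<Longrightarrow> \<bar>c i\<bar> \<le> M" for c
  proof -
    have "r * of_int \<bar>c (e i)\<bar> / of_int M \<le> r" for i
    proof -
      have "real_of_int \<bar>c (e i)\<bar> \<le> of_int M" using that[OF en] of_int_le_iff by blast
      then show ?thesis using r M by (simp add: divide_le_eq)
    qed
    then show ?thesis unfolding Q_def by (simp only: p_abs mem_Collect_eq) simp
  qed
  \<comment> \<open>An antipodal choice of sign for nonzero cells. It decides the sign of a component
  that vanishes at the centre of a cell.\<close>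
  define pos where "pos c \<longleftrightarrow> c (LEAST j. c j \<noteq> 0) > 0" for c :: "nat \<Rightarrow> int"
  have pos_minus: "pos (- c) \<longleftrightarrow> \<not> pos c" if "c i \<noteq> 0" for c i
  proof -
    have "c (LEAST j. c j \<noteq> 0) \<noteq> 0" by (rule LeastI[of _ i]) (rule that)
    then show ?thesis by (auto simp: pos_def)
  qed
  define s :: "nat \<Rightarrow> (nat \<Rightarrow> int) \<Rightarrow> bit" where
    "s d c = (let y = f (p c) $ e' d in if y > 0 \<or> y = 0 \<and> pos c then 1 else 0)" for d c
  have anti: "s d (- c) = s d c + 1" if c: "on_boundary M n c" for d c
  proof -
    obtain i where i: "i < n" "\<bar>c i\<bar> = M" using c by (auto simp: on_boundary_def)
    then have "i \<in> range e" using e by (simp add: bij_betw_def)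
    then obtain j where j: "i = e j" by blast
    have "f (- p c) = - f (p c)"
    proof (rule odd)
      show "\<forall>j. \<bar>p c $ j\<bar> \<le> r" using p_Q[of c] c by (auto simp: Q_def on_boundary_def)
      show "\<bar>p c $ j\<bar> = r" using M i unfolding p_abs j by simp
    qed
    moreover have "pos (- c) \<longleftrightarrow> \<not> pos c" using i M pos_minus[of c i] by auto
    ultimately show ?thesis
      unfolding s_def Let_def p_minus by auto
  qed
  have "(\<Sum>c\<in>box_cells (\<lambda>_. - M) (\<lambda>_. M) {..<n}. sign_cochain s n n c) = 1"
    by (rule sum_sign_cochain_cube) (use M anti in auto)
  then obtain c where c: "c \<in> box_cells (\<lambda>_. - M) (\<lambda>_. M) {..<n}" "sign_cochain s n n c \<noteq> 0"
    by (metis sum.neutral zero_neq_one)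
  have face_le: "\<bar>g i\<bar> \<le> M" if "face g c" "i < n" for g i
  proof -
    have "- M < c i" "c i < M" using c(1) that(2) by (auto simp: box_cells_def odds_def)
    moreover have "\<bar>g i - c i\<bar> \<le> 1" using that(1) unfolding face_def by (metis abs_zero cancel_comm_monoid_add_class.diff_cancel order.refl zero_le_one)
    ultimately show ?thesis by linarith
  qed
  have "face c c" by (simp add: face_def)
  have cQ: "p c \<in> Q" using p_Q face_le[OF \<open>face c c\<close>] by blast
  have near: "p g \<in> Q \<and> dist (p g) (p c) < \<delta>" if "face g c" for g
  proof
    show "p g \<in> Q" using p_Q face_le[OF that] by blast
    have "\<bar>(p g - p c) $ i\<bar> \<le> r / of_int M" for i
    proof -
      have "\<bar>g (e i) - c (e i)\<bar> \<le> 1"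
        using that unfolding face_def by (metis abs_zero cancel_comm_monoid_add_class.diff_cancel order.refl zero_le_one)
      then have "real_of_int \<bar>g (e i) - c (e i)\<bar> \<le> 1" by linarith
      moreover have "(p g - p c) $ i = r * of_int (g (e i) - c (e i)) / of_int M"
        by (simp add: p_def diff_divide_distrib right_diff_distrib)
      ultimately show ?thesis using r M by (simp add: abs_mult divide_right_mono mult_left_le)
    qed
    then have "norm (p g - p c) \<le> (\<Sum>i\<in>(UNIV::'n set). r / of_int M)"
      by (intro order.trans[OF norm_le_l1_cart] sum_mono) blast
    also have "\<dots> = n * r / (2 * N)" by (simp add: n_def M_def)
    also have "\<dots> < \<delta>"
    proof -
      have "n * r < N * \<delta>" using N \<delta>(1) by (simp add: divide_less_eq)
      moreover have "0 < N * \<delta>" using \<open>N > 0\<close> \<delta>(1) by simp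
      ultimately have "n * r < (2 * N) * \<delta>" by simp
      then show ?thesis using \<open>N > 0\<close> by (simp add: divide_less_eq mult.commute)
    qed
    finally show "dist (p g) (p c) < \<delta>" by (simp add: dist_norm)
  qed
  have small: "\<bar>f (p c) $ i\<bar> < \<epsilon> / n" for i
  proof -
    obtain g h where gh: "face g c" "face h c" "s (e i) g \<noteq> s (e i) h"
      using sign_cochain_nonzero_imp_sign_change[OF c(2) en] by blast
    have "\<exists>g. face g c \<and> \<bar>f (p c) $ i\<bar> \<le> \<bar>(f (p g) - f (p c)) $ i\<bar>"
    proof -
      from gh(3) have "f (p g) $ i \<ge> 0 \<and> f (p h) $ i \<le> 0 \<or> f (p g) $ i \<le> 0 \<and> f (p h) $ i \<ge> 0"
        unfolding s_def Let_def e' by (auto split: if_splits)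
      then have "\<bar>f (p c) $ i\<bar> \<le> \<bar>(f (p g) - f (p c)) $ i\<bar> \<or> \<bar>f (p c) $ i\<bar> \<le> \<bar>(f (p h) - f (p c)) $ i\<bar>"
        by auto
      then show ?thesis using gh by blast
    qed
    then obtain g where g: "face g c" "\<bar>f (p c) $ i\<bar> \<le> \<bar>(f (p g) - f (p c)) $ i\<bar>" by blast
    note g(2)
    also have "\<bar>(f (p g) - f (p c)) $ i\<bar> \<le> dist (f (p g)) (f (p c))" unfolding dist_norm by (rule component_le_norm_cart)
    also have "\<dots> < \<epsilon> / n" using near[OF g(1)] cQ \<delta>(2) by blast
    finally show ?thesis .
  qed
  have "norm (f (p c)) \<le> (\<Sum>i\<in>UNIV. \<bar>f (p c) $ i\<bar>)" by (rule norm_le_l1_cart)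
  also have "\<dots> < (\<Sum>i\<in>(UNIV::'n set). \<epsilon> / n)" by (rule sum_strict_mono) (use small in auto)
  also have "\<dots> = \<epsilon>" using n by (simp add: n_def)
  finally show False using \<epsilon>(2)[OF cQ] by simp
qed

section \<open>Tensors acting on tuples\<close>

lemma tensor_apply_scaleR:
  "tensor_apply m A (c *\<^sub>R x) = c ^ (m - 1) *\<^sub>R tensor_apply m A x"
proof -
  have "prod_list (map (\<lambda>j. (c *\<^sub>R x) $ j) js) = c ^ length js * prod_list (map (\<lambda>j. x $ j) js)" for js
    by (induction js) (simp_all add: mult_ac)
  then show ?thesis
    by (auto simp: tensor_apply_def vec_eq_iff sum_distrib_left intro!: sum.cong)
qed

lemma continuous_on_tensor_apply [continuous_intros]:
  assumes "continuous_on S g"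
  shows "continuous_on S (\<lambda>x. tensor_apply m A (g x))"
proof -
  have "continuous_on S (\<lambda>x. prod_list (map (\<lambda>j. g x $ j) js))" for js
    by (induction js) (auto intro!: continuous_intros assms)
  then show ?thesis
    unfolding tensor_apply_def by (intro continuous_intros)
qed

definition balance :: "nat \<Rightarrow> nat \<Rightarrow> (nat \<Rightarrow> 'n::finite tensor) \<Rightarrow> (nat \<Rightarrow> real^'n) \<Rightarrow> real^'n" where
  "balance m k A x = tensor_apply m (A 0) (x 0) - (\<Sum>j = 1..k. tensor_apply m (A j) (x j))"

definition total_norm :: "nat \<Rightarrow> (nat \<Rightarrow> real^'n::finite) \<Rightarrow> real" where
  "total_norm k x = (\<Sum>j = 0..k. norm (x j))"

text \<open>
  The cone from the definition of EHE tensors. Unlike in a solution of the complementarity system,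
  \<open>x 0\<close> may have negative components.
\<close>

definition sign_cone :: "nat \<Rightarrow> (nat \<Rightarrow> real^'n::finite) set" where
  "sign_cone k = {x. \<forall>i \<in> {1..k}. 0 \<le> x i \<and> x 0 * x i \<le> 0}"

lemma continuous_map_tuple_component:
  "j \<le> k \<Longrightarrow> continuous_map (tuple_topology k) euclidean (\<lambda>x. x j)"
  unfolding tuple_topology_def by (rule continuous_map_product_projection) simp

lemma topspace_tuple_topology: "topspace (tuple_topology k) = {0..k} \<rightarrow>\<^sub>E UNIV"
  by (simp add: tuple_topology_def)

lemma continuous_map_balance: "continuous_map (tuple_topology k) euclidean (balance m k A)"
proof -
  have "continuous_map (tuple_topology k) euclidean (\<lambda>x. tensor_apply m (A j) (x j))" if "j \<le> k" for j
    using continuous_map_compose[OF continuous_map_tuple_component[OF that],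
        of euclidean "tensor_apply m (A j)"]
    by (simp add: o_def continuous_on_tensor_apply continuous_on_id)
  then show ?thesis
    unfolding balance_def by (intro continuous_intros) auto
qed

lemma continuous_map_total_norm: "continuous_map (tuple_topology k) euclideanreal (total_norm k)"
  unfolding total_norm_def
  by (intro continuous_intros continuous_map_tuple_component) auto

lemma closedin_tuple_components:
  fixes P :: "real^'n::finite \<Rightarrow> real^'n \<Rightarrow> bool"
  assumes "i \<le> k" "j \<le> k" "closed {z. P (fst z) (snd z)}"
  shows "closedin (tuple_topology k) {x \<in> topspace (tuple_topology k). P (x i) (x j)}"
proof -
  have "continuous_map (tuple_topology k) euclidean (\<lambda>x :: nat \<Rightarrow> real^'n. (x i, x j))"
    unfolding prod_topology_euclidean[symmetric]
    by (intro continuous_map_pairedI continuous_map_tuple_component assms)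
  from closedin_continuous_map_preimage[OF this, of "{z. P (fst z) (snd z)}"]
  show ?thesis using assms by simp
qed

lemma compactin_tuple_bounded:
  assumes "closedin (tuple_topology k) S" "\<And>x. x \<in> S \<Longrightarrow> total_norm k x \<le> R"
  shows "compactin (tuple_topology k) S"
proof (rule closed_compactin[OF _ _ assms(1)])
  show "compactin (tuple_topology k) ({0..k} \<rightarrow>\<^sub>E cball 0 R)"
    unfolding tuple_topology_def by (simp add: compactin_PiE)
  show "S \<subseteq> {0..k} \<rightarrow>\<^sub>E cball 0 R"
  proof
    fix x assume "x \<in> S"
    then have x: "x \<in> {0..k} \<rightarrow>\<^sub>E UNIV" using closedin_subset[OF assms(1)] topspace_tuple_topology by blast
    have "norm (x j) \<le> R" if "j \<in> {0..k}" for j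
      using member_le_sum[OF that, of "\<lambda>j. norm (x j)"] assms(2)[OF \<open>x \<in> S\<close>] by (simp add: total_norm_def)
    then show "x \<in> {0..k} \<rightarrow>\<^sub>E cball 0 R" using x by (auto simp: PiE_iff)
  qed
qed


section \<open>Coercivity of EHE tensors\<close>

lemma EHE_zero:
  assumes "EHE m k A" "x \<in> {0..k} \<rightarrow>\<^sub>E UNIV" "x \<in> sign_cone k" "balance m k A x = 0" "j \<le> k"
  shows "x j = 0"
  using assms by (auto simp: EHE_def sign_cone_def balance_def)

lemma balance_scaleR: "balance m k A (\<lambda>j. c *\<^sub>R x j) = c ^ (m - 1) *\<^sub>R balance m k A x"
  by (simp add: balance_def tensor_apply_scaleR scaleR_diff_right scaleR_sum_right)

lemma balance_cong: "(\<And>j. j \<le> k \<Longrightarrow> x j = y j) \<Longrightarrow> balance m k A x = balance m k A y"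
  by (simp add: balance_def)

text \<open>
  On the tuples of total norm \<open>1\<close> in the cone the norm of \<open>balance\<close> has a positive minimum, and
  \<open>balance\<close> is homogeneous of degree \<open>m - 1\<close>.
\<close>

lemma EHE_coercive:
  assumes "EHE m k A" "m > 1"
  obtains \<epsilon> where "\<epsilon> > 0"
    "\<And>x. x \<in> sign_cone k \<Longrightarrow> \<epsilon> * total_norm k x ^ (m - 1) \<le> norm (balance m k A x)"
proof -
  let ?T = "tuple_topology k :: (nat \<Rightarrow> real^'a) topology"
  define K where "K = {x \<in> topspace ?T. x \<in> sign_cone k \<and> total_norm k x = 1}"
  have "compactin ?T K"
  proof (rule compactin_tuple_bounded[where R = 1])
    have cl: "closed {z :: (real^'a) \<times> (real^'a). 0 \<le> snd z \<and> fst z * snd z \<le> 0}"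
      unfolding less_eq_vec_def
      by (intro closed_Collect_conj closed_Collect_all closed_Collect_le) (auto intro!: continuous_intros)
    have "closedin ?T {x \<in> topspace ?T. i \<ge> 1 \<longrightarrow> 0 \<le> x i \<and> x 0 * x i \<le> 0}" if "i \<le> k" for i
      using closedin_tuple_components[OF _ that cl, of 0] by (cases "i \<ge> 1") auto
    then have "closedin ?T (\<Inter>i\<in>{0..k}. {x \<in> topspace ?T. i \<ge> 1 \<longrightarrow> 0 \<le> x i \<and> x 0 * x i \<le> 0})"
      by (intro closedin_INT) auto
    moreover have "closedin ?T {x \<in> topspace ?T. total_norm k x \<in> {1}}"
      by (rule closedin_continuous_map_preimage[OF continuous_map_total_norm]) simp
    ultimately have "closedin ?T ((\<Inter>i\<in>{0..k}. {x \<in> topspace ?T. i \<ge> 1 \<longrightarrow> 0 \<le> x i \<and> x 0 * x i \<le> 0})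
        \<inter> {x \<in> topspace ?T. total_norm k x \<in> {1}})"
      by (rule closedin_Int)
    also have "\<dots> = K" by (auto simp: K_def sign_cone_def)
    finally show "closedin ?T K" .
  qed (simp add: K_def)
  then have cpt: "compact (norm ` balance m k A ` K)"
    using image_compactin[OF \<open>compactin ?T K\<close> continuous_map_balance[of k m A]]
    by (auto intro!: compact_continuous_image continuous_intros)
  have pos: "norm (balance m k A x) > 0" if "x \<in> K" for x
  proof -
    have "balance m k A x \<noteq> 0"
    proof
      assume "balance m k A x = 0"
      with that have "x j = 0" if "j \<le> k" for j
        using EHE_zero[OF assms(1) _ _ _ \<open>j \<le> k\<close>] by (simp add: K_def topspace_tuple_topology)
      then have "total_norm k x = 0" by (simp add: total_norm_def)
      then show False using that by (simp add: K_def)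
    qed
    then show ?thesis by simp
  qed
  have "\<exists>\<epsilon>>0. \<forall>x\<in>K. \<epsilon> \<le> norm (balance m k A x)"
  proof (cases "K = {}")
    case False
    with compact_attains_inf[OF cpt] obtain x
      where "x \<in> K" "\<And>y. y \<in> K \<Longrightarrow> norm (balance m k A x) \<le> norm (balance m k A y)"
      by auto
    with pos show ?thesis by blast
  next
    case True
    then show ?thesis by (auto intro: exI[of _ 1])
  qed
  then obtain \<epsilon> where \<epsilon>: "\<epsilon> > 0" "\<And>x. x \<in> K \<Longrightarrow> \<epsilon> \<le> norm (balance m k A x)"
    by blast
  show thesis
  proof (rule that[OF \<epsilon>(1)])
    fix x :: "nat \<Rightarrow> real^'a" assume x: "x \<in> sign_cone k"
    define \<rho> where "\<rho> = total_norm k x"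
    have "\<rho> \<ge> 0" by (simp add: \<rho>_def total_norm_def sum_nonneg)
    show "\<epsilon> * total_norm k x ^ (m - 1) \<le> norm (balance m k A x)"
    proof (cases "\<rho> = 0")
      case True
      then show ?thesis using assms(2) by (simp add: \<rho>_def power_0_left)
    next
      case False
      with \<open>\<rho> \<ge> 0\<close> have \<rho>: "\<rho> > 0" by simp
      define y where "y = restrict (\<lambda>j. inverse \<rho> *\<^sub>R x j) {0..k}"
      have "total_norm k y = inverse \<rho> * total_norm k x"
        using \<rho> by (simp add: total_norm_def y_def sum_distrib_left)
      then have "total_norm k y = 1" using \<rho> by (simp add: \<rho>_def)
      moreover have "y \<in> sign_cone k"
        using x \<rho> by (auto simp: sign_cone_def y_def less_eq_vec_def mult_le_0_iff)
      ultimately have "y \<in> K" by (auto simp: K_def topspace_tuple_topology y_def)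
      then have "\<epsilon> \<le> norm (balance m k A y)" by (rule \<epsilon>(2))
      also have "balance m k A y = balance m k A (\<lambda>j. inverse \<rho> *\<^sub>R x j)"
        by (rule balance_cong) (simp add: y_def)
      also have "norm \<dots> = norm (balance m k A x) / \<rho> ^ (m - 1)"
        using \<rho> by (simp add: balance_scaleR power_inverse divide_inverse mult.commute)
      finally show ?thesis using \<rho> by (simp add: \<rho>_def pos_le_divide_eq)
    qed
  qed
qed

text \<open>
  The bound that coercivity gives for the norm \<open>\<rho>\<close> of a tuple whose \<open>balance\<close> has norm at most \<open>b\<close>.
  If it failed, the summand \<open>1\<close> would give \<open>1 \<le> \<rho>\<close> and hence \<open>\<rho> \<le> \<rho>\<^sup>m\<^sup>-\<^sup>1\<close>.
\<close>

lemma total_norm_bound: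
  assumes "\<epsilon> > 0" "m > 1" "\<epsilon> * \<rho> ^ (m - 1) \<le> b" "b \<ge> 0"
  shows "\<rho> < b / \<epsilon> + (1 :: real)"
proof (rule ccontr)
  assume no: "\<not> ?thesis"
  have "b / \<epsilon> \<ge> 0" using assms by simp
  then have "\<rho> \<ge> 1" using no by linarith
  then have "\<rho> \<le> \<rho> ^ (m - 1)" using assms(2) by (intro self_le_power) auto
  also have "\<dots> \<le> b / \<epsilon>" using assms by (simp add: pos_le_divide_eq mult.commute)
  finally show False using no by simp
qed

section \<open>Compactness of the solution set\<close>

lemma inf_eq_zero_vec_iff:
  "inf u v = (0 :: real^'n::finite) \<longleftrightarrow> (\<forall>i. min (u $ i) (v $ i) = 0)"
  by (simp add: vec_eq_iff inf_vec_def inf_min)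

lemma SOL_iff:
  "x \<in> SOL m k A d q \<longleftrightarrow> x \<in> {0..k} \<rightarrow>\<^sub>E UNIV \<and> balance m k A x = q \<and> inf (x 0) (x 1) = 0 \<and>
     (\<forall>j \<in> {1..<k}. inf (d j - x j) (x (j + 1)) = 0)"
  by (auto simp: SOL_def balance_def algebra_simps)

text \<open>
  In a coordinate where \<open>x\<^sub>0 > 0\<close>, the conditions force \<open>x\<^sub>1 = 0 < d\<^sub>1\<close>, hence \<open>x\<^sub>2 = 0 < d\<^sub>2\<close>, and so on.
\<close>

lemma SOL_sign_cone:
  assumes d: "\<forall>j \<in> {1..<k}. \<forall>i. d j $ i > 0" and x: "x \<in> SOL m k A d q"
  shows "x \<in> sign_cone k"
proof -
  note x = x[unfolded SOL_iff inf_eq_zero_vec_iff]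
  have x0: "min (x 0 $ i) (x 1 $ i) = 0" for i using x by blast
  have next_zero: "min (d j $ i - x j $ i) (x (Suc j) $ i) = 0" if "j \<in> {1..<k}" for j i
    using x that by fastforce
  have nonneg: "x j $ i \<ge> 0" if "j \<in> {1..k}" for j i
  proof (cases "j = 1")
    case True
    then show ?thesis using x0[of i] by (simp add: min_def split: if_splits)
  next
    case False
    then obtain j' where "j = Suc j'" "j' \<in> {1..<k}" using \<open>j \<in> {1..k}\<close> by (cases j) auto
    then show ?thesis using next_zero[of j' i] by (simp add: min_def split: if_splits)
  qed
  have zero: "j \<ge> 1 \<Longrightarrow> j \<le> k \<Longrightarrow> x 0 $ i > 0 \<Longrightarrow> x j $ i = 0" for j i
  proof (induction j rule: dec_induct)
    case base
    then show ?case using x0[of i] by (simp add: min_def split: if_splits)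
  next
    case (step j)
    have "j \<in> {1..<k}" using step by auto
    then have "d j $ i > 0" using d by blast
    moreover have "x j $ i = 0" using step by simp
    ultimately show ?case
      using next_zero[OF \<open>j \<in> {1..<k}\<close>, of i] by (auto simp: min_def split: if_splits)
  qed
  have "x 0 $ i * x j $ i \<le> 0" if "j \<in> {1..k}" for i j
    using zero[of j i] nonneg[OF that, of i] that
    by (cases "x 0 $ i > 0") (auto simp: mult_le_0_iff)
  then show ?thesis using nonneg by (auto simp: sign_cone_def less_eq_vec_def)
qed

text \<open>
  Solutions are bounded by coercivity, since they lie in the cone and have \<open>balance\<close> equal to \<open>q\<close>.
\<close>

lemma SOL_compact:
  fixes A :: "nat \<Rightarrow> 'n::finite tensor"
  assumes "EHE m k A" "m > 1" "k \<ge> 1" and d: "\<forall>j \<in> {1..<k}. \<forall>i. d j $ i > 0"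
  shows "compactin (tuple_topology k) (SOL m k A d q)"
proof -
  let ?T = "tuple_topology k :: (nat \<Rightarrow> real^'n) topology"
  obtain \<epsilon> where \<epsilon>: "\<epsilon> > 0"
    "\<And>x. x \<in> sign_cone k \<Longrightarrow> \<epsilon> * total_norm k x ^ (m - 1) \<le> norm (balance m k A x)"
    using EHE_coercive[OF assms(1,2)] by blast
  show ?thesis
  proof (rule compactin_tuple_bounded)
    fix x assume x: "x \<in> SOL m k A d q"
    then have "norm (balance m k A x) = norm q" by (simp add: SOL_iff)
    then show "total_norm k x \<le> norm q / \<epsilon> + 1"
      using total_norm_bound[OF \<epsilon>(1) assms(2)] \<epsilon>(2)[OF SOL_sign_cone[OF d x]]
      by (metis less_imp_le norm_ge_zero)
  next
    have cl: "closed {z :: (real^'n) \<times> (real^'n). inf (u + c *\<^sub>R fst z) (snd z) = 0}" for u c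
      unfolding inf_eq_zero_vec_iff
      by (intro closed_Collect_all closed_Collect_eq continuous_on_min) (auto intro!: continuous_intros)
    let ?C = "\<lambda>j. {x \<in> topspace ?T. if j = 0 then inf (x 0) (x 1) = 0 else inf (d j - x j) (x (j + 1)) = 0}"
    have "closedin ?T (?C j)" if "j < k" for j
      using closedin_tuple_components[OF _ _ cl[of 0 1], of 0 k 1]
        closedin_tuple_components[OF _ _ cl[of "d j" "- 1"], of j k "j + 1"] that assms(3)
      by (cases "j = 0") auto
    then have "closedin ?T (\<Inter>j\<in>{0..<k}. ?C j)"
      using assms(3) by (intro closedin_INT) auto
    moreover have "closedin ?T {x \<in> topspace ?T. balance m k A x \<in> {q}}"
      by (rule closedin_continuous_map_preimage[OF continuous_map_balance]) simp
    ultimately have "closedin ?T ((\<Inter>j\<in>{0..<k}. ?C j) \<inter> {x \<in> topspace ?T. balance m k A x \<in> {q}})"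
      by (rule closedin_Int)
    also have "\<dots> = SOL m k A d q"
    proof (intro set_eqI)
      fix x :: "nat \<Rightarrow> real^'n"
      have "(\<forall>j\<in>{0..<k}. if j = 0 then inf (x 0) (x 1) = 0 else inf (d j - x j) (x (j + 1)) = 0) \<longleftrightarrow>
        inf (x 0) (x 1) = 0 \<and> (\<forall>j \<in> {1..<k}. inf (d j - x j) (x (j + 1)) = 0)"
        using assms(3) by (force simp: Suc_le_eq)
      then show "x \<in> (\<Inter>j\<in>{0..<k}. ?C j) \<inter> {x \<in> topspace ?T. balance m k A x \<in> {q}} \<longleftrightarrow> x \<in> SOL m k A d q"
        unfolding SOL_iff topspace_tuple_topology by blast
    qed
    finally show "closedin ?T (SOL m k A d q)" .
  qed
qed

section \<open>Existence of solutions\<close>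

text \<open>
  The positive part of \<open>t - (d\<^sub>1 + \<dots> + d\<^sub>j\<^sub>-\<^sub>1)\<close>: how far the parameter \<open>t\<close> exceeds the value at which
  \<open>x\<^sub>j\<close> starts to grow. With the convention \<open>0\<close> for \<open>j > k\<close>, the difference of consecutive ramps is
  \<open>x\<^sub>j\<close> for every \<open>j\<close> from \<open>1\<close> to \<open>k\<close>, including the unbounded last one.
\<close>

definition ramp :: "nat \<Rightarrow> (nat \<Rightarrow> real^'n) \<Rightarrow> nat \<Rightarrow> real^'n \<Rightarrow> real^'n::finite" where
  "ramp k d j t = (\<chi> i. if j \<le> k then max (t $ i - (\<Sum>l = 1..<j. d l $ i)) 0 else 0)"

text \<open>
  For \<open>c = 1\<close> this parametrizes the tuples that satisfy the complementarity conditions: \<open>x\<^sub>0\<close> is the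
  negative part of \<open>t\<close> and \<open>x\<^sub>j\<close> is \<open>t - (d\<^sub>1 + \<dots> + d\<^sub>j\<^sub>-\<^sub>1)\<close> truncated to the interval from \<open>0\<close> to
  \<open>d\<^sub>j\<close>, where \<open>d\<^sub>k\<close> is to be read as infinity. For
  \<open>c = 0\<close> only \<open>x\<^sub>0 = - t\<close> is left, which is odd in \<open>t\<close>.
\<close>

definition homotopy_tuple :: "nat \<Rightarrow> (nat \<Rightarrow> real^'n) \<Rightarrow> real \<Rightarrow> real^'n \<Rightarrow> nat \<Rightarrow> real^'n::finite" where
  "homotopy_tuple k d c t j =
     (if j = 0 then c *\<^sub>R ramp k d 1 t - t else c *\<^sub>R (ramp k d j t - ramp k d (j + 1) t))"

lemma continuous_on_homotopy_tuple:
  assumes "continuous_on S c"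
  shows "continuous_on S (\<lambda>t. homotopy_tuple k d (c t) t j)"
proof -
  have "continuous_on S (\<lambda>t. ramp k d j t)" for j
    unfolding ramp_def by (cases "j \<le> k") (auto intro!: continuous_intros)
  then show ?thesis
    using assms unfolding homotopy_tuple_def by (cases "j = 0") (auto intro!: continuous_intros)
qed

lemma ramp_1: "k \<ge> 1 \<Longrightarrow> ramp k d 1 t $ i = max (t $ i) 0"
  by (simp add: ramp_def)

lemma ramp_nonneg: "ramp k d j t $ i \<ge> 0"
  by (simp add: ramp_def)

lemma ramp_beyond: "j > k \<Longrightarrow> ramp k d j t $ i = 0"
  by (simp add: ramp_def)

lemma ramp_Suc:
  assumes "d j $ i > 0" "j \<in> {1..<k}"
  shows "ramp k d (j + 1) t $ i = max (ramp k d j t $ i - d j $ i) 0"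
  using assms by (auto simp: ramp_def max_def)

lemma ramp_decreasing:
  assumes d: "\<forall>j \<in> {1..<k}. \<forall>i. d j $ i > 0" and "j \<ge> 1"
  shows "ramp k d (j + 1) t $ i \<le> ramp k d j t $ i"
proof (cases "j < k")
  case True
  then show ?thesis
    using d ramp_Suc[of d j i k t] ramp_nonneg[of k d j t i] \<open>j \<ge> 1\<close>
    by (simp add: less_imp_le)
next
  case False
  then show ?thesis using ramp_nonneg[of k d j t i] ramp_beyond[of k "j + 1" d t i] by simp
qed

lemma ramp_zero:
  assumes d: "\<forall>j \<in> {1..<k}. \<forall>i. d j $ i > 0" and "j \<ge> 1" "k \<ge> 1" "t $ i \<le> 0"
  shows "ramp k d j t $ i = 0"
  using assms(2)
proof (induction j rule: dec_induct)
  case base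
  then show ?case using assms by (simp add: ramp_1[simplified])
next
  case (step j)
  then show ?case
    using ramp_decreasing[OF d, of j t i] ramp_nonneg[of k d "j + 1" t i] by simp
qed

text \<open>
  Coordinates with \<open>t \<le> 0\<close> have \<open>x\<^sub>j = 0\<close> for \<open>j \<ge> 1\<close>; coordinates with \<open>t > 0\<close> have
  \<open>x\<^sub>0 = (c - 1) t \<le> 0\<close>. The latter needs the freedom of sign of \<open>x\<^sub>0\<close> in the cone.
\<close>

lemma homotopy_tuple_sign_cone:
  assumes d: "\<forall>j \<in> {1..<k}. \<forall>i. d j $ i > 0" and k: "k \<ge> 1" and c: "0 \<le> c" "c \<le> 1"
  shows "homotopy_tuple k d c t \<in> sign_cone k"
proof -
  have nonneg: "homotopy_tuple k d c t j $ i \<ge> 0" if "j \<ge> 1" for i j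
    using that ramp_decreasing[OF d that, of t i] c by (simp add: homotopy_tuple_def)
  have "homotopy_tuple k d c t 0 $ i * homotopy_tuple k d c t j $ i \<le> 0" if "j \<ge> 1" for i j
  proof (cases "t $ i \<le> 0")
    case True
    then have "homotopy_tuple k d c t j $ i = 0"
      using ramp_zero[OF d _ k True, of j] ramp_zero[OF d _ k True, of "j + 1"] that
      by (simp add: homotopy_tuple_def)
    then show ?thesis by simp
  next
    case False
    then have "homotopy_tuple k d c t 0 $ i = (c - 1) * t $ i"
      using ramp_1[OF k, of d t i] by (simp add: homotopy_tuple_def algebra_simps)
    then have "homotopy_tuple k d c t 0 $ i \<le> 0"
      using False c by (simp add: mult_le_0_iff)
    then show ?thesis using nonneg[OF that, of i] by (simp add: mult_le_0_iff)
  qed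
  then show ?thesis using nonneg by (simp add: sign_cone_def less_eq_vec_def)
qed

text \<open>
  The ramps telescope to \<open>t = (x\<^sub>1 + \<dots> + x\<^sub>k) - x\<^sub>0\<close> for every \<open>c\<close>, so the tuple is large wherever \<open>t\<close>
  is, at every stage of the homotopy.
\<close>

lemma norm_le_total_norm_homotopy_tuple:
  assumes "k \<ge> 1"
  shows "norm t \<le> total_norm k (homotopy_tuple k d c t)"
proof -
  let ?x = "homotopy_tuple k d c t"
  have "(\<Sum>j = 1..k. ?x j) = c *\<^sub>R (\<Sum>j = 1..k. ramp k d j t - ramp k d (Suc j) t)"
    by (simp add: homotopy_tuple_def scaleR_sum_right)
  also have "(\<Sum>j = 1..k. ramp k d j t - ramp k d (Suc j) t) = ramp k d 1 t - ramp k d (Suc k) t"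
    using sum_Suc_diff[of 1 k "\<lambda>j. - ramp k d j t"] assms by (simp add: algebra_simps)
  also have "ramp k d (Suc k) t = 0" by (simp add: vec_eq_iff ramp_beyond)
  finally have "t = (\<Sum>j = 1..k. ?x j) - ?x 0" by (simp add: homotopy_tuple_def)
  then have "norm t \<le> norm (\<Sum>j = 1..k. ?x j) + norm (?x 0)"
    by (metis norm_triangle_ineq4)
  also have "\<dots> \<le> (\<Sum>j = 1..k. norm (?x j)) + norm (?x 0)"
    by (simp add: norm_sum)
  also have "\<dots> = total_norm k ?x"
    by (simp add: total_norm_def sum.atLeast_Suc_atMost)
  finally show ?thesis .
qed

lemma homotopy_tuple_SOL:
  assumes d: "\<forall>j \<in> {1..<k}. \<forall>i. d j $ i > 0" and k: "k \<ge> 1"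
    and eq: "balance m k A (homotopy_tuple k d 1 t) = q"
  shows "restrict (homotopy_tuple k d 1 t) {0..k} \<in> SOL m k A d q"
proof -
  let ?x = "homotopy_tuple k d 1 t"
  have "min (?x 0 $ i) (?x 1 $ i) = 0" for i
  proof (cases "t $ i \<le> 0")
    case True
    then show ?thesis
      using ramp_zero[OF d _ k True, of 1] ramp_zero[OF d _ k True, of 2]
      by (simp add: homotopy_tuple_def numeral_2_eq_2)
  next
    case False
    then show ?thesis
      using ramp_1[OF k, of d t i] ramp_decreasing[OF d, of 1 t i]
      by (simp add: homotopy_tuple_def numeral_2_eq_2 min_def)
  qed
  moreover have "min (d j $ i - ?x j $ i) (?x (j + 1) $ i) = 0" if j: "j \<in> {1..<k}" for i j
  proof -
    have dj: "d j $ i > 0" using d j by blast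
    have mono: "ramp k d (j + 2) t $ i \<le> ramp k d (j + 1) t $ i"
      using ramp_decreasing[OF d, of "j + 1" t i] by simp
    show ?thesis
    proof (cases "ramp k d j t $ i \<le> d j $ i")
      case True
      then have "ramp k d (j + 1) t $ i = 0" using ramp_Suc[of d j i k t, OF dj j] by simp
      then show ?thesis
        using mono ramp_nonneg[of k d "j + 2" t i] True j by (simp add: homotopy_tuple_def)
    next
      case False
      then have "ramp k d (j + 1) t $ i = ramp k d j t $ i - d j $ i"
        using ramp_Suc[of d j i k t, OF dj j] by simp
      then show ?thesis using mono j by (simp add: homotopy_tuple_def)
    qed
  qed
  ultimately have "inf (?x 0) (?x 1) = 0" "\<forall>j \<in> {1..<k}. inf (d j - ?x j) (?x (j + 1)) = 0"
    unfolding inf_eq_zero_vec_iff by simp_all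
  moreover have "balance m k A (restrict ?x {0..k}) = q"
    unfolding eq[symmetric] by (rule balance_cong) simp
  ultimately show ?thesis using k by (simp add: SOL_iff)
qed

lemma SOL_nonempty:
  fixes A :: "nat \<Rightarrow> 'n::finite tensor"
  assumes EHE: "EHE m k A" and m: "m > 1" "even m" and k: "k \<ge> 1"
    and d: "\<forall>j \<in> {1..<k}. \<forall>i. d j $ i > 0"
  shows "SOL m k A d q \<noteq> {}"
proof -
  obtain \<epsilon> where \<epsilon>: "\<epsilon> > 0"
    "\<And>x. x \<in> sign_cone k \<Longrightarrow> \<epsilon> * total_norm k x ^ (m - 1) \<le> norm (balance m k A x)"
    using EHE_coercive[OF EHE m(1)] by blast
  define R where "R = norm q / \<epsilon> + 1"
  have R: "R > 0" using \<epsilon>(1) by (simp add: R_def add_nonneg_pos)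
  \<comment> \<open>The stage of the homotopy: \<open>1\<close> for norm at most \<open>R\<close> and \<open>0\<close> for norm at least \<open>2 * R\<close>, hence
  \<open>0\<close> on the boundary of the cube of half side length \<open>2 * R\<close>. The right-hand side \<open>q\<close> is scaled
  along with it, because an odd map must not retain a constant term.\<close>
  define c where "c t = max 0 (min 1 (2 - norm t / R))" for t :: "real^'n"
  have c: "0 \<le> c t" "c t \<le> 1" for t by (simp_all add: c_def)
  define F where "F t = balance m k A (homotopy_tuple k d (c t) t) - c t *\<^sub>R q" for t
  have "continuous_on S c" for S
    unfolding c_def using R by (auto intro!: continuous_intros)
  then have "continuous_on S F" for S
    unfolding F_def balance_def by (intro continuous_intros continuous_on_homotopy_tuple) auto
  then have F_cont: "continuous_on {x. \<forall>i. \<bar>x $ i\<bar> \<le> 2 * R} F" .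
  have F_odd: "F (- t) = - F t" if "\<bar>t $ i\<bar> = 2 * R" for t i
  proof -
    have "norm t \<ge> 2 * R" using component_le_norm_cart[of t i] that by simp
    then have "norm t / R \<ge> 2" using R by (simp add: pos_le_divide_eq)
    then have "c t = 0" "c (- t) = 0" by (simp_all add: c_def)
    moreover have "homotopy_tuple k d 0 (- t) = (\<lambda>j. (- 1) *\<^sub>R homotopy_tuple k d 0 t j)"
      by (auto simp: homotopy_tuple_def)
    moreover have "(- 1 :: real) ^ (m - 1) = - 1" using m by simp
    ultimately show ?thesis
      unfolding F_def by (simp only: balance_scaleR) simp
  qed
  have "\<exists>t. (\<forall>i. \<bar>t $ i\<bar> \<le> 2 * R) \<and> F t = 0"
    by (rule odd_on_cube_boundary_has_zero[OF _ F_cont]) (use R F_odd in auto)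
  then obtain t where "F t = 0" by blast
  then have eq: "balance m k A (homotopy_tuple k d (c t) t) = c t *\<^sub>R q"
    by (simp add: F_def)
  \<comment> \<open>Coercivity excludes zeros of norm at least \<open>R\<close>, so the zero found lies where \<open>c t = 1\<close>.\<close>
  have "\<epsilon> * total_norm k (homotopy_tuple k d (c t) t) ^ (m - 1) \<le> norm (c t *\<^sub>R q)"
    using \<epsilon>(2)[OF homotopy_tuple_sign_cone[OF d k c]] eq by metis
  also have "\<dots> \<le> norm q" using c[of t] by (simp add: mult_left_le_one_le)
  finally have "total_norm k (homotopy_tuple k d (c t) t) < R"
    unfolding R_def by (rule total_norm_bound[OF \<epsilon>(1) m(1)]) simp
  then have "norm t < R"
    using norm_le_total_norm_homotopy_tuple[OF k, of t d "c t"] by linarith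
  then have "norm t / R < 1" using R by simp
  then have "c t = 1" by (simp add: c_def)
  then show ?thesis using homotopy_tuple_SOL[OF d k] eq by force
qed

theorem theorem4p4:
  fixes m k :: nat and A :: "nat \<Rightarrow> 'n::finite tensor"
  assumes "m > 0" and "even m" and "k \<ge> 1"
    and "EHE m k A"
  shows "\<forall>(d :: nat \<Rightarrow> real^'n) (q :: real^'n).
           (\<forall>j \<in> {1..<k}. \<forall>i. d j $ i > 0) \<longrightarrow>
           SOL m k A d q \<noteq> {} \<and> compactin (tuple_topology k) (SOL m k A d q)"
proof -
  have "m > 1" using assms(1,2) by (cases "m = 1") auto
  then show ?thesis using SOL_nonempty SOL_compact assms(2-4) by blast
qed

end
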